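(* Let $0<\beta<2$, $d\in\mathbb{N}$ and $R>0$. Then for every $\mu>0$ there exists $u\in C_c^\infty(\mathbb{R}^d)$ such that \[0<\Gamma_2(u)(x)<\mu\big(\mathcal{L}u(x)\big)^2\quad\text{for all }x\in\mathbb{R}^d\text{ with }|x|\le R.\] In particular, the curvature-dimension inequality $\Gamma_2(u)\ge\frac1N(\mathcal{L}u)^2$ (i.e. $CD(0,N)$) fails on all of $\overline{B_R(0)}$ for every finite $N>0$.
   Context: $c_{\beta,d}=\frac{2^\beta\Gamma(\frac{d+\beta}{2})}{\pi^{d/2}|\Gamma(-\frac{\beta}{2})|}$; $\mathcal{L}u(x)=c_{\beta,d}\int_{\mathbb{R}^d}\frac{u(x+h)-2u(x)+u(x-h)}{|h|^{d+\beta}}dh$; $\Gamma_2(u)(x)=c_{\beta,d}^2\int_{\mathbb{R}^d}\int_{\mathbb{R}^d}\frac{[u(x+h+\sigma)-u(x+h)-u(x+\sigma)+u(x)]^2}{|h|^{d+\beta}|\sigma|^{d+\beta}}dh\,d\sigma$. *)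

theory Defs
  imports "HOL-Analysis.Analysis"
begin

fun C_k :: "nat \<Rightarrow> ('a::euclidean_space \<Rightarrow> real) \<Rightarrow> bool" where
  "C_k 0 f = continuous_on UNIV f"
| "C_k (Suc k) f = ((\<forall>x. f differentiable (at x)) \<and>
      (\<forall>i\<in>Basis. C_k k (\<lambda>x. frechet_derivative f (at x) i)))"

definition smooth :: "('a::euclidean_space \<Rightarrow> real) \<Rightarrow> bool" where
  "smooth f \<longleftrightarrow> (\<forall>k. C_k k f)"

definition compact_support :: "('a::euclidean_space \<Rightarrow> real) \<Rightarrow> bool" where
  "compact_support f \<longleftrightarrow> compact (closure {x. f x \<noteq> 0})"

definition c_const :: "real \<Rightarrow> nat \<Rightarrow> real" where
  "c_const \<beta> d = 2 powr \<beta> * Gamma ((real d + \<beta>) / 2) /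
      (pi powr (real d / 2) * \<bar>Gamma (- \<beta> / 2)\<bar>)"

definition fracL :: "real \<Rightarrow> (real^'n \<Rightarrow> real) \<Rightarrow> real^'n \<Rightarrow> real" where
  "fracL \<beta> u x = c_const \<beta> CARD('n) *
     (LINT h|lborel. (u (x + h) - 2 * u x + u (x - h)) / norm h powr (real CARD('n) + \<beta>))"

definition Gamma2 :: "real \<Rightarrow> (real^'n \<Rightarrow> real) \<Rightarrow> real^'n \<Rightarrow> real" where
  "Gamma2 \<beta> u x = (c_const \<beta> CARD('n))\<^sup>2 *
     (LINT h|lborel. LINT \<sigma>|lborel.
        (u (x + h + \<sigma>) - u (x + h) - u (x + \<sigma>) + u x)\<^sup>2 /
        (norm h powr (real CARD('n) + \<beta>) * norm \<sigma> powr (real CARD('n) + \<beta>)))"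

end

theory Submission
  imports Defs
begin

text \<open>
  The measure with density \<open>1 / |h| powr (d + \<beta>)\<close> is homogeneous of degree \<open>- \<beta>\<close>, so the dilates
  \<open>r powr \<beta> * \<phi> (x / r)\<close> of a cutoff \<open>\<phi>\<close> have \<open>fracL\<close> and \<open>Gamma2\<close> of size independent of \<open>r\<close>. On
  the ball of radius \<open>R\<close>, where all dilates with \<open>r \<ge> R\<close> attain their maximum, their fractional
  Laplacians share the same sign and add up, so the sum over \<open>r = R * 2 ^ k\<close>, \<open>k < K\<close>, has
  \<open>(fracL)\<^sup>2\<close> of order at least \<open>K\<^sup>2\<close>. The quadratic form \<open>Gamma2\<close>, however, is almost orthogonal
  on different scales: \<open>\<phi>\<close> has mixed differences at most \<open>C * min 1 |h| * min 1 |\<sigma>|\<close>, and with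
  this bound the cross term of scales \<open>j\<close> and \<open>k\<close> decays geometrically in \<open>|j - k|\<close>. Hence
  \<open>Gamma2\<close> is at most of order \<open>K\<close>, and \<open>Gamma2 / (fracL)\<^sup>2\<close> tends to 0.
\<close>

subsection \<open>Functions of class $C^k$\<close>

lemma C_k_SucI:
  assumes "\<And>x. (f has_derivative f' x) (at x)"
    and "\<And>i. i \<in> Basis \<Longrightarrow> C_k k (\<lambda>x. f' x i)"
  shows "C_k (Suc k) f"
proof -
  have "frechet_derivative f (at x) = f' x" for x
    using frechet_derivative_at[OF assms(1)] by simp
  then show ?thesis
    using assms by (auto simp: differentiable_def)
qed

lemma C_k_Suc_has_derivative:
  assumes "C_k (Suc k) f"
  shows "(f has_derivative frechet_derivative f (at x)) (at x)"
  using assms by (simp add: frechet_derivative_works[symmetric])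

lemma C_k_Suc_imp_C_k: "C_k (Suc k) f \<Longrightarrow> C_k k f"
proof (induction k arbitrary: f)
  case 0
  then show ?case
    by (auto intro!: continuous_at_imp_continuous_on differentiable_imp_continuous_within)
next
  case (Suc k)
  then have "C_k k (\<lambda>x. frechet_derivative f (at x) i)" if "i \<in> Basis" for i
    using that C_k.simps(2)[of "Suc k" f] by blast
  moreover have "f differentiable (at x)" for x
    using Suc.prems C_k.simps(2)[of "Suc k" f] by blast
  ultimately show ?case by simp
qed

lemma C_k_const: "C_k k (\<lambda>_. c)"
proof (induction k arbitrary: c)
  case (Suc k)
  show ?case
    by (rule C_k_SucI[where f' = "\<lambda>_ _. 0"]) (auto intro: Suc.IH)
qed auto

lemma C_k_add:
  assumes "C_k k f" "C_k k g"
  shows "C_k k (\<lambda>x. f x + g x)"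
  using assms
proof (induction k arbitrary: f g)
  case 0
  then show ?case by (auto intro: continuous_on_add)
next
  case (Suc k)
  have "C_k k (\<lambda>x. frechet_derivative f (at x) i)" "C_k k (\<lambda>x. frechet_derivative g (at x) i)"
    if "i \<in> Basis" for i
    using Suc.prems that by auto
  then show ?case
    by (intro C_k_SucI[OF has_derivative_add[OF Suc.prems[THEN C_k_Suc_has_derivative]]] Suc.IH)
qed

lemma C_k_mult:
  assumes "C_k k f" "C_k k g"
  shows "C_k k (\<lambda>x. f x * g x)"
  using assms
proof (induction k arbitrary: f g)
  case 0
  then show ?case by (auto intro: continuous_on_mult)
next
  case (Suc k)
  have "C_k k f" "C_k k g"
    using Suc.prems C_k_Suc_imp_C_k by blast+
  moreover have "C_k k (\<lambda>x. frechet_derivative f (at x) i)"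
    "C_k k (\<lambda>x. frechet_derivative g (at x) i)"
    if "i \<in> Basis" for i
    using Suc.prems that by auto
  ultimately show ?case
    by (intro C_k_SucI[OF has_derivative_mult[OF Suc.prems[THEN C_k_Suc_has_derivative]]]
        C_k_add Suc.IH)
qed

lemma C_k_compose_real:
  fixes g :: "'a::euclidean_space \<Rightarrow> real"
  assumes D: "\<And>n t. (D n has_real_derivative D (Suc n) t) (at t)"
    and g: "\<And>k. C_k k g"
  shows "C_k k (\<lambda>x. D n (g x))"
proof (induction k arbitrary: n)
  case 0
  have "continuous_on UNIV (D n)"
    using DERIV_isCont[OF D] by (auto intro!: continuous_at_imp_continuous_on)
  moreover have "continuous_on UNIV g"
    using g[of 0] by simp
  ultimately show ?case
    by (auto intro: continuous_on_compose2)
next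
  case (Suc k)
  have "((\<lambda>x. D n (g x)) has_derivative
      (\<lambda>h. D (Suc n) (g x) * frechet_derivative g (at x) h)) (at x)" for x
    using has_derivative_compose[OF C_k_Suc_has_derivative[OF g]
        D[of n "g x", unfolded has_field_derivative_def]] by simp
  then show ?case
    by (rule C_k_SucI) (use Suc.IH g[of "Suc k"] in \<open>auto intro!: C_k_mult\<close>)
qed

lemma C_k_compose_scaleR:
  fixes f :: "'a::euclidean_space \<Rightarrow> real"
  assumes "C_k k f"
  shows "C_k k (\<lambda>x. f (c *\<^sub>R x))"
  using assms
proof (induction k arbitrary: f)
  case 0
  then show ?case
    by (auto intro!: continuous_intros continuous_on_compose2[of UNIV f])
next
  case (Suc k)
  let ?D = "\<lambda>x. frechet_derivative f (at x)"
  have "((\<lambda>x. f (c *\<^sub>R x)) has_derivative (\<lambda>h. ?D (c *\<^sub>R x) (c *\<^sub>R h))) (at x)" for x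
    by (rule has_derivative_compose[OF _ C_k_Suc_has_derivative[OF Suc.prems]])
      (auto intro!: derivative_eq_intros)
  moreover have "?D y (c *\<^sub>R h) = c * ?D y h" for y h
    using has_derivative_linear[OF C_k_Suc_has_derivative[OF Suc.prems]]
    by (simp add: linear_cmul)
  moreover have "C_k k (\<lambda>x. c * ?D (c *\<^sub>R x) i)" if "i \<in> Basis" for i
    using Suc that by (intro C_k_mult C_k_const Suc.IH[of "\<lambda>x. ?D x i"]) auto
  ultimately show ?case
    by (intro C_k_SucI) auto
qed

lemma C_k_inner_left: "C_k k (\<lambda>x. x \<bullet> a)"
proof (cases k)
  case (Suc l)
  have "((\<lambda>x. x \<bullet> a) has_derivative (\<lambda>h. h \<bullet> a)) (at x)" for x
    by (auto intro!: derivative_eq_intros)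
  then show ?thesis
    unfolding Suc by (rule C_k_SucI) (rule C_k_const)
qed (auto intro: continuous_intros)

lemma C_k_norm_squared: "C_k k (\<lambda>x. (norm x)\<^sup>2)"
proof (cases k)
  case 0
  then show ?thesis by (auto intro: continuous_intros)
next
  case (Suc l)
  have "((\<lambda>x. x \<bullet> x) has_derivative (\<lambda>h. 2 * (x \<bullet> h))) (at x)" for x :: 'a
    by (auto intro!: derivative_eq_intros simp: inner_commute)
  then show ?thesis
    unfolding Suc power2_norm_eq_inner
    by (rule C_k_SucI) (auto intro!: C_k_mult C_k_const C_k_inner_left)
qed

lemma smooth_const: "smooth (\<lambda>_. c)"
  by (simp add: smooth_def C_k_const)

lemma smooth_add: "smooth f \<Longrightarrow> smooth g \<Longrightarrow> smooth (\<lambda>x. f x + g x)"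
  by (simp add: smooth_def C_k_add)

lemma smooth_mult: "smooth f \<Longrightarrow> smooth g \<Longrightarrow> smooth (\<lambda>x. f x * g x)"
  by (simp add: smooth_def C_k_mult)

lemma smooth_sum:
  "finite I \<Longrightarrow> (\<And>i. i \<in> I \<Longrightarrow> smooth (f i)) \<Longrightarrow> smooth (\<lambda>x. \<Sum>i\<in>I. f i x)"
  by (induction rule: finite_induct) (auto intro: smooth_const smooth_add)

lemma smooth_norm_squared: "smooth (\<lambda>x. (norm x)\<^sup>2)"
  by (simp add: smooth_def C_k_norm_squared)

lemma smooth_compose_scaleR: "smooth f \<Longrightarrow> smooth (\<lambda>x. f (c *\<^sub>R x))"
  by (simp add: smooth_def C_k_compose_scaleR)

lemma smooth_imp_continuous_on: "smooth f \<Longrightarrow> continuous_on UNIV f"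
  unfolding smooth_def using C_k.simps(1) by blast

lemma smooth_imp_borel_measurable: "smooth f \<Longrightarrow> f \<in> borel_measurable borel"
  by (intro borel_measurable_continuous_onI smooth_imp_continuous_on)

lemma smooth_has_derivative:
  "smooth f \<Longrightarrow> (f has_derivative frechet_derivative f (at x)) (at x)"
  unfolding smooth_def using C_k_Suc_has_derivative by blast

lemma smooth_frechet_derivative:
  assumes "smooth f" "i \<in> Basis"
  shows "smooth (\<lambda>x. frechet_derivative f (at x) i)"
  unfolding smooth_def
proof
  fix k
  have "C_k (Suc k) f"
    using assms(1) unfolding smooth_def by blast
  then show "C_k k (\<lambda>x. frechet_derivative f (at x) i)"
    using assms(2) by simp
qed

subsection \<open>A smooth cutoff\<close>

definition flat_exp :: "real poly \<Rightarrow> real \<Rightarrow> real" where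
  "flat_exp p t = (if t > 0 then poly p (1 / t) * exp (- 1 / t) else 0)"

lemma tendsto_poly_times_exp_minus: "((\<lambda>s. poly p s * exp (- s)) \<longlongrightarrow> (0::real)) at_top"
proof -
  have "((\<lambda>s. \<Sum>i\<le>degree p. coeff p i * (s ^ i / exp s)) \<longlongrightarrow> (\<Sum>i\<le>degree p. coeff p i * 0)) at_top"
    by (intro tendsto_intros tendsto_power_div_exp_0)
  then show ?thesis
    by (simp add: poly_altdef sum_distrib_right exp_minus divide_inverse mult.assoc)
qed

lemma tendsto_flat_exp_at_0: "(flat_exp p \<longlongrightarrow> 0) (at 0)"
proof (rule filterlim_split_at)
  show "(flat_exp p \<longlongrightarrow> 0) (at_left 0)"
    by (rule tendsto_eventually) (auto simp: flat_exp_def eventually_at_filter)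
  have "((\<lambda>t. poly p (inverse t) * exp (- inverse t)) \<longlongrightarrow> 0) (at_right 0)"
    by (rule filterlim_compose[OF tendsto_poly_times_exp_minus filterlim_inverse_at_top_right])
  then show "(flat_exp p \<longlongrightarrow> 0) (at_right 0)"
    by (rule Lim_transform_eventually)
      (auto simp: flat_exp_def eventually_at_filter divide_inverse)
qed

lemma has_real_derivative_flat_exp:
  "(flat_exp p has_real_derivative flat_exp (monom 1 2 * (p - pderiv p)) t) (at t)"
proof -
  consider (pos) "t > 0" | (neg) "t < 0" | (zero) "t = 0" by linarith
  then show ?thesis
  proof cases
    case pos
    have "((\<lambda>t. poly p (1 / t) * exp (- 1 / t)) has_real_derivative
        flat_exp (monom 1 2 * (p - pderiv p)) t) (at t)"
      using pos by (auto intro!: derivative_eq_intros DERIV_chain2[OF poly_DERIV]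
          simp: flat_exp_def poly_monom field_simps power2_eq_square)
    then show ?thesis
      by (rule has_field_derivative_transform_within_open[of _ _ _ "{0<..}"])
        (use pos in \<open>auto simp: flat_exp_def\<close>)
  next
    case neg
    have "((\<lambda>_. 0) has_real_derivative flat_exp (monom 1 2 * (p - pderiv p)) t) (at t)"
      using neg by (simp add: flat_exp_def)
    then show ?thesis
      by (rule has_field_derivative_transform_within_open[of _ _ _ "{..<0}"])
        (use neg in \<open>auto simp: flat_exp_def\<close>)
  next
    case zero
    have "((\<lambda>h. flat_exp p h / h) \<longlongrightarrow> 0) (at 0)"
      by (rule Lim_transform_eventually[OF tendsto_flat_exp_at_0[of "monom 1 1 * p"]])
        (auto simp: flat_exp_def eventually_at_filter poly_monom)
    then show ?thesis
      using zero by (simp add: DERIV_def flat_exp_def)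
  qed
qed

lemma smooth_flat_exp_compose:
  assumes "smooth g"
  shows "smooth (\<lambda>x. flat_exp p (g x))"
proof -
  define D where "D n = flat_exp (((\<lambda>p. monom 1 2 * (p - pderiv p)) ^^ n) p)" for n
  have "(D n has_real_derivative D (Suc n) t) (at t)" for n t
    unfolding D_def funpow.simps o_apply by (rule has_real_derivative_flat_exp)
  then have "C_k k (\<lambda>x. D 0 (g x))" for k
    by (rule C_k_compose_real[of D g k 0]) (use assms in \<open>auto simp: smooth_def\<close>)
  then show ?thesis
    by (simp add: smooth_def D_def)
qed

lemma flat_exp_1_nonneg: "0 \<le> flat_exp 1 t"
  by (simp add: flat_exp_def)

lemma flat_exp_1_mono: "s \<le> t \<Longrightarrow> flat_exp 1 s \<le> flat_exp 1 t"
  by (auto simp: flat_exp_def frac_le)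

text \<open>The inner term vanishes for \<open>norm x \<le> 1\<close>, and the outer one for \<open>norm x \<ge> 2\<close> because
  \<open>4 * exp (- 1) \<ge> 1\<close>; nesting avoids the usual quotient.\<close>

definition cutoff :: "'a::euclidean_space \<Rightarrow> real" where
  "cutoff x = exp 1 * flat_exp 1 (1 - 4 * flat_exp 1 ((norm x)\<^sup>2 - 1))"

lemma smooth_cutoff: "smooth (cutoff :: 'a::euclidean_space \<Rightarrow> real)"
proof -
  have "smooth (\<lambda>x::'a. exp 1 * flat_exp 1 (1 + - 4 * flat_exp 1 ((norm x)\<^sup>2 + - 1)))"
    by (intro smooth_add smooth_mult smooth_const smooth_flat_exp_compose smooth_norm_squared)
  then show ?thesis
    by (simp add: cutoff_def[abs_def])
qed

lemma cutoff_nonneg: "0 \<le> cutoff x"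
  by (simp add: cutoff_def flat_exp_1_nonneg)

lemma cutoff_le_1: "cutoff x \<le> 1"
proof -
  have "cutoff x \<le> exp 1 * flat_exp 1 1"
    unfolding cutoff_def by (intro mult_left_mono flat_exp_1_mono) (auto simp: flat_exp_1_nonneg)
  then show ?thesis
    by (simp add: flat_exp_def mult_exp_exp)
qed

lemma cutoff_eq_1: "norm x \<le> 1 \<Longrightarrow> cutoff x = 1"
  using power_le_one[of "norm x" 2] by (simp add: cutoff_def flat_exp_def mult_exp_exp)

lemma cutoff_eq_0:
  assumes "2 \<le> norm x"
  shows "cutoff x = 0"
proof -
  have "2\<^sup>2 \<le> (norm x)\<^sup>2"
    using assms by (intro power_mono) auto
  then have "flat_exp 1 1 \<le> flat_exp 1 ((norm x)\<^sup>2 - 1)"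
    by (intro flat_exp_1_mono) auto
  moreover have "1 / 4 \<le> flat_exp 1 1"
    using exp_le by (simp add: flat_exp_def exp_minus field_simps)
  ultimately show ?thesis
    by (simp add: cutoff_def flat_exp_def[of _ "1 - _"])
qed

subsection \<open>Compactly supported functions and mixed differences\<close>

lemma compact_support_iff: "compact_support f \<longleftrightarrow> (\<exists>T. \<forall>x. T < norm x \<longrightarrow> f x = 0)"
  unfolding compact_support_def compact_closure bounded_iff by (auto simp: not_less[symmetric])

lemma compact_support_cutoff: "compact_support cutoff"
  unfolding compact_support_iff using cutoff_eq_0 less_imp_le by blast

lemma compact_support_imp_bounded:
  assumes "continuous_on UNIV f" "compact_support f"
  shows "\<exists>B. \<forall>x. \<bar>f x\<bar> \<le> B"
proof -
  obtain T where T: "\<And>x. T < norm x \<Longrightarrow> f x = 0"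
    using assms(2) unfolding compact_support_iff by blast
  have "compact (f ` cball 0 T)"
    using assms(1) by (intro compact_continuous_image) (auto intro: continuous_on_subset)
  then obtain B where B: "\<forall>y\<in>f ` cball 0 T. norm y \<le> B"
    using compact_imp_bounded bounded_iff by metis
  have "\<bar>f x\<bar> \<le> max B 0" for x
  proof (cases "T < norm x")
    case False
    then have "norm (f x) \<le> B"
      using B by simp
    then show ?thesis by simp
  qed (simp add: T)
  then show ?thesis by blast
qed

lemma compact_support_frechet_derivative:
  assumes "compact_support f"
  shows "compact_support (\<lambda>x. frechet_derivative f (at x) i)"
proof -
  obtain T where T: "\<And>x. T < norm x \<Longrightarrow> f x = 0"
    using assms unfolding compact_support_iff by blast
  have "frechet_derivative f (at x) i = 0" if "T < norm x" for x
  proof -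
    have "open {x::'a. T < norm x}"
      by (intro open_Collect_less continuous_intros)
    then have "(f has_derivative (\<lambda>_. 0)) (at x)"
      by (rule has_derivative_transform_within_open[OF has_derivative_const]) (use that T in auto)
    then show ?thesis
      using frechet_derivative_at by metis
  qed
  then show ?thesis
    unfolding compact_support_iff by blast
qed

definition trunc_norm :: "'a::real_normed_vector \<Rightarrow> real" where
  "trunc_norm h = min 1 (norm h)"

lemma trunc_norm_nonneg: "0 \<le> trunc_norm h"
  by (simp add: trunc_norm_def)

lemma trunc_norm_minus: "trunc_norm (- h) = trunc_norm h"
  by (simp add: trunc_norm_def)

lemma trunc_norm_le_1: "trunc_norm h \<le> 1"
  by (simp add: trunc_norm_def)

lemma trunc_norm_le_norm: "trunc_norm h \<le> norm h"
  by (simp add: trunc_norm_def)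

lemma trunc_norm_le_powr:
  assumes "0 \<le> \<theta>" "\<theta> \<le> 1"
  shows "trunc_norm h \<le> norm h powr \<theta>"
proof (cases "norm h < 1")
  case True
  then show ?thesis
    using powr_mono'[of \<theta> 1 "norm h"] assms by (simp add: trunc_norm_def)
next
  case False
  then show ?thesis
    using assms ge_one_powr_ge_zero[of "norm h" \<theta>] by (simp add: trunc_norm_def)
qed

lemma trunc_norm_measurable [measurable]: "trunc_norm \<in> borel_measurable borel"
  unfolding trunc_norm_def by measurable

lemma abs_difference_le_trunc_norm:
  fixes g :: "'a::euclidean_space \<Rightarrow> real"
  assumes diff: "\<And>x. (g has_derivative g' x) (at x)"
    and g: "\<And>x. \<bar>g x\<bar> \<le> B"
    and g': "\<And>x i. i \<in> Basis \<Longrightarrow> \<bar>g' x i\<bar> \<le> B' i"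
  shows "\<bar>g (x + h) - g x\<bar> \<le> (2 * B + (\<Sum>i\<in>Basis. B' i)) * trunc_norm h"
proof -
  have B_nonneg: "0 \<le> B" "0 \<le> (\<Sum>i\<in>Basis. B' i)"
    using order_trans[OF abs_ge_zero g[of 0]] order_trans[OF abs_ge_zero g'[of _ 0]]
    by (auto intro: sum_nonneg)
  have "onorm (g' x) \<le> (\<Sum>i\<in>Basis. norm (g' x i))" for x
    by (rule onorm_componentwise[OF has_derivative_bounded_linear[OF diff]])
  also have "(\<Sum>i\<in>Basis. norm (g' x i)) \<le> (\<Sum>i\<in>Basis. B' i)" for x
    by (rule sum_mono) (use g' in auto)
  finally have "norm (g (x + h) - g x) \<le> (\<Sum>i\<in>Basis. B' i) * norm ((x + h) - x)"
    by (intro differentiable_bound[of UNIV g g']) (use diff in auto)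
  moreover have "\<bar>g (x + h) - g x\<bar> \<le> 2 * B"
    using g[of "x + h"] g[of x] by linarith
  ultimately show ?thesis
    using B_nonneg by (auto simp: trunc_norm_def min_def algebra_simps intro: add_increasing2)
qed

lemma smooth_abs_difference_le:
  fixes u :: "'a::euclidean_space \<Rightarrow> real"
  assumes "smooth u" "compact_support u"
  shows "\<exists>C. \<forall>x h. \<bar>u (x + h) - u x\<bar> \<le> C * trunc_norm h"
proof -
  obtain B where B: "\<And>x. \<bar>u x\<bar> \<le> B"
    using compact_support_imp_bounded[OF smooth_imp_continuous_on] assms by metis
  have "\<exists>B'. \<forall>x. \<bar>frechet_derivative u (at x) i\<bar> \<le> B'" if "i \<in> Basis" for i
    using assms that
    by (intro compact_support_imp_bounded smooth_imp_continuous_on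
        smooth_frechet_derivative compact_support_frechet_derivative)
  then obtain B' where "\<And>x i. i \<in> Basis \<Longrightarrow> \<bar>frechet_derivative u (at x) i\<bar> \<le> B' i"
    by metis
  from abs_difference_le_trunc_norm[OF smooth_has_derivative[OF assms(1)] B this]
  show ?thesis by blast
qed

definition mixed_difference :: "('a::real_vector \<Rightarrow> real) \<Rightarrow> 'a \<Rightarrow> 'a \<Rightarrow> 'a \<Rightarrow> real" where
  "mixed_difference u x h s = u (x + h + s) - u (x + h) - u (x + s) + u x"

lemma mixed_difference_minus:
  "mixed_difference u x h (- h) = 2 * u x - u (x + h) - u (x - h)"
  by (simp add: mixed_difference_def)

lemma smooth_abs_mixed_difference_le:
  fixes u :: "'a::euclidean_space \<Rightarrow> real"
  assumes u: "smooth u" "compact_support u"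
  shows "\<exists>C. \<forall>x h s. \<bar>mixed_difference u x h s\<bar> \<le> C * (trunc_norm h * trunc_norm s)"
proof -
  let ?D = "\<lambda>x. frechet_derivative u (at x)"
  obtain C where C: "\<And>x s. \<bar>u (x + s) - u x\<bar> \<le> C * trunc_norm s"
    using smooth_abs_difference_le[OF u] by blast
  have "\<exists>C'. \<forall>x s. \<bar>?D (x + s) i - ?D x i\<bar> \<le> C' * trunc_norm s" if "i \<in> Basis" for i
    using u that
    by (intro smooth_abs_difference_le smooth_frechet_derivative compact_support_frechet_derivative)
  then obtain C' where C': "\<And>x s i. i \<in> Basis \<Longrightarrow> \<bar>?D (x + s) i - ?D x i\<bar> \<le> C' i * trunc_norm s"
    by metis
  have shift: "((\<lambda>x. u (x + s)) has_derivative ?D (x + s)) (at x)" for x s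
    by (rule has_derivative_compose[OF _ smooth_has_derivative[OF u(1)],
          of "\<lambda>x. x + s" "\<lambda>h. h" x UNIV])
      (auto intro!: derivative_eq_intros)
  have increment_le: "\<bar>(u (x + h + s) - u (x + h)) - (u (x + s) - u x)\<bar>
      \<le> (2 * (C * trunc_norm s) + (\<Sum>i\<in>Basis. C' i * trunc_norm s)) * trunc_norm h" for x h s
    by (rule abs_difference_le_trunc_norm[OF
          has_derivative_diff[OF shift smooth_has_derivative[OF u(1)]]])
      (use C C' in auto)
  have "\<bar>mixed_difference u x h s\<bar>
      \<le> (2 * C + (\<Sum>i\<in>Basis. C' i)) * (trunc_norm h * trunc_norm s)" for x h s
    using increment_le[of x h s]
    by (simp add: mixed_difference_def algebra_simps sum_distrib_left sum_distrib_right)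
  then show ?thesis by blast
qed

subsection \<open>The Levy measure\<close>

definition levy_measure :: "real \<Rightarrow> 'a::euclidean_space measure" where
  "levy_measure \<beta> = density lborel (\<lambda>h. ennreal (1 / norm h powr (real DIM('a) + \<beta>)))"

lemma sets_levy_measure [simp, measurable_cong]: "sets (levy_measure \<beta>) = sets borel"
  by (simp add: levy_measure_def)

lemma space_levy_measure [simp]: "space (levy_measure \<beta>) = UNIV"
  by (simp add: levy_measure_def)

lemma sigma_finite_levy_measure: "sigma_finite_measure (levy_measure \<beta>)"
  unfolding levy_measure_def
  by (subst sigma_finite_measure.sigma_finite_iff_density_finite[OF sigma_finite_lborel]) auto

lemma pair_sigma_finite_levy_measure: "pair_sigma_finite (levy_measure \<beta>) (levy_measure \<beta>)"
  by (intro pair_sigma_finite.intro sigma_finite_levy_measure)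

lemma integral_levy_measure:
  fixes f :: "'a::euclidean_space \<Rightarrow> real"
  assumes "f \<in> borel_measurable borel"
  shows "(LINT h|levy_measure \<beta>. f h) = (LINT h|lborel. f h / norm h powr (real DIM('a) + \<beta>))"
  unfolding levy_measure_def using assms by (subst integral_density) auto

lemma distr_lborel_scaleR_inverse:
  assumes "0 < r"
  shows "distr lborel borel (\<lambda>h::'a::euclidean_space. h /\<^sub>R r)
    = density lborel (\<lambda>_. ennreal (r ^ DIM('a)))"
proof -
  let ?N = "distr lborel borel (\<lambda>h::'a. h /\<^sub>R r)"
  have "lborel = density ?N (\<lambda>_. ennreal (inverse r ^ DIM('a)))"
    using lborel_affine[of "inverse r" "0::'a"] assms by simp
  then have "density lborel (\<lambda>_. ennreal (r ^ DIM('a)))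
      = density (density ?N (\<lambda>_. ennreal (inverse r ^ DIM('a)))) (\<lambda>_. ennreal (r ^ DIM('a)))"
    by simp
  also have "\<dots> = density ?N (\<lambda>_. 1)"
    using assms
    by (simp add: density_density_eq ennreal_mult[symmetric] power_mult_distrib[symmetric])
  finally show ?thesis
    by (simp add: density_1)
qed

lemma distr_levy_measure_scaleR_inverse:
  fixes \<beta> :: real
  assumes "0 < r"
  shows "distr (levy_measure \<beta>) borel (\<lambda>h::'a::euclidean_space. h /\<^sub>R r)
    = density (levy_measure \<beta>) (\<lambda>_. ennreal (r powr - \<beta>))"
proof -
  let ?T = "\<lambda>h::'a. h /\<^sub>R r"
  define e where "e = real DIM('a) + \<beta>"
  let ?k = "\<lambda>h::'a. ennreal (1 / norm h powr e)"
  let ?k' = "\<lambda>h::'a. ennreal (r powr - e / norm h powr e)"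
  have levy: "levy_measure \<beta> = density lborel ?k"
    by (simp add: levy_measure_def e_def)
  have "?k = (\<lambda>h. ?k' (?T h))"
    using assms by (intro ext) (simp add: powr_divide powr_minus field_simps)
  then have "distr (levy_measure \<beta>) borel ?T = distr (density lborel (\<lambda>h. ?k' (?T h))) borel ?T"
    unfolding levy by (rule arg_cong)
  also have "\<dots> = density (distr lborel borel ?T) ?k'"
    by (rule density_distr[symmetric]) auto
  also have "\<dots> = density lborel (\<lambda>h. ennreal (r ^ DIM('a)) * ?k' h)"
    by (simp add: distr_lborel_scaleR_inverse[OF assms] density_density_eq)
  also have "(\<lambda>h. ennreal (r ^ DIM('a)) * ?k' h) = (\<lambda>h. ?k h * ennreal (r powr - \<beta>))"
    using assms
    by (simp add: ennreal_mult[symmetric] e_def powr_diff powr_minus powr_realpow powr_add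
        field_simps)
  finally show ?thesis
    by (simp add: levy density_density_eq)
qed

lemma nn_integral_levy_measure_scaleR_inverse:
  assumes "0 < r" "f \<in> borel_measurable borel"
  shows "(\<integral>\<^sup>+h. f (h /\<^sub>R r) \<partial>levy_measure \<beta>) = ennreal (r powr - \<beta>) * (\<integral>\<^sup>+h. f h \<partial>levy_measure \<beta>)"
proof -
  have "(\<integral>\<^sup>+h. f (h /\<^sub>R r) \<partial>levy_measure \<beta>)
      = (\<integral>\<^sup>+h. f h \<partial>distr (levy_measure \<beta>) borel (\<lambda>h. h /\<^sub>R r))"
    using assms by (simp add: nn_integral_distr)
  then show ?thesis
    using assms
    by (simp add: distr_levy_measure_scaleR_inverse nn_integral_density nn_integral_cmult)
qed

lemma
  fixes f :: "'a::euclidean_space \<Rightarrow> real"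
  assumes r: "0 < r" and f: "integrable (levy_measure \<beta>) f"
  shows integrable_levy_measure_scaleR_inverse: "integrable (levy_measure \<beta>) (\<lambda>h. f (h /\<^sub>R r))"
    and integral_levy_measure_scaleR_inverse:
      "(LINT h|levy_measure \<beta>. f (h /\<^sub>R r)) = r powr - \<beta> * (LINT h|levy_measure \<beta>. f h)"
proof -
  have [measurable]: "f \<in> borel_measurable borel"
    using borel_measurable_integrable[OF f] by simp
  have "integrable (density (levy_measure \<beta>) (\<lambda>_. ennreal (r powr - \<beta>))) f"
    using f by (simp add: integrable_density)
  then show "integrable (levy_measure \<beta>) (\<lambda>h. f (h /\<^sub>R r))"
    by (simp add: distr_levy_measure_scaleR_inverse[OF r, symmetric] integrable_distr_eq)
  have "(LINT h|levy_measure \<beta>. f (h /\<^sub>R r))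
      = (LINT h|distr (levy_measure \<beta>) borel (\<lambda>h. h /\<^sub>R r). f h)"
    by (simp add: integral_distr)
  then show "(LINT h|levy_measure \<beta>. f (h /\<^sub>R r)) = r powr - \<beta> * (LINT h|levy_measure \<beta>. f h)"
    by (simp add: distr_levy_measure_scaleR_inverse[OF r] integral_density)
qed

lemma ex_power_of_two_interval:
  fixes x :: real
  assumes "1 \<le> x"
  shows "\<exists>k. 2 ^ k \<le> x \<and> x \<le> 2 * 2 ^ k"
proof -
  define k where "k = nat \<lfloor>log 2 x\<rfloor>"
  have "0 \<le> log 2 x"
    using assms by simp
  then have "real k \<le> log 2 x" "log 2 x \<le> real (Suc k)"
    unfolding k_def by linarith+
  then have "2 powr real k \<le> x" "x \<le> 2 powr real (Suc k)"
    using assms by (simp_all add: le_log_iff log_le_iff del: of_nat_Suc)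
  then have "2 ^ k \<le> x \<and> x \<le> 2 * 2 ^ k"
    by (simp add: powr_realpow powr_add)
  then show ?thesis ..
qed

definition annulus :: "real \<Rightarrow> 'a::real_normed_vector set" where
  "annulus r = {h. r \<le> norm h \<and> norm h \<le> 2 * r}"

lemma annulus_measurable [measurable]: "annulus r \<in> sets borel"
  unfolding annulus_def by measurable

lemma nn_integral_levy_measure_annulus_1:
  "(\<integral>\<^sup>+h. ennreal (norm h powr \<theta>) * indicator (annulus 1) h
    \<partial>(levy_measure \<beta> :: 'a::euclidean_space measure)) < \<infinity>"
proof -
  let ?A = "annulus 1 :: 'a set"
  let ?f = "\<lambda>h::'a. norm h powr \<theta> / norm h powr (real DIM('a) + \<beta>)"
  have "?A = cball 0 2 - ball 0 1"
    by (auto simp: annulus_def)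
  then have "compact ?A"
    by (simp add: compact_diff)
  moreover have "continuous_on ?A ?f"
    by (intro continuous_intros) (auto simp: annulus_def)
  ultimately have "integrable lborel (\<lambda>h. indicator ?A h *\<^sub>R ?f h)"
    by (rule borel_integrable_compact)
  then have "(\<integral>\<^sup>+h. ennreal (norm (indicator ?A h *\<^sub>R ?f h)) \<partial>lborel) < \<infinity>"
    unfolding integrable_iff_bounded by blast
  also have "(\<lambda>h. ennreal (norm (indicator ?A h *\<^sub>R ?f h)))
      = (\<lambda>h. ennreal (1 / norm h powr (real DIM('a) + \<beta>))
        * (ennreal (norm h powr \<theta>) * indicator ?A h))"
    by (auto simp: indicator_def ennreal_mult[symmetric])
  finally show ?thesis
    unfolding levy_measure_def by (subst nn_integral_density) auto
qed

lemma nn_integral_levy_measure_annulus: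
  assumes "0 < r"
  shows "(\<integral>\<^sup>+h. ennreal (norm h powr \<theta>) * indicator (annulus r) h
      \<partial>(levy_measure \<beta> :: 'a::euclidean_space measure))
    = ennreal (r powr (\<theta> - \<beta>)) * (\<integral>\<^sup>+h. ennreal (norm h powr \<theta>) * indicator (annulus 1) h
      \<partial>(levy_measure \<beta> :: 'a measure))"
proof -
  define g where "g h = ennreal (norm h powr \<theta>) * indicator (annulus 1) h" for h :: 'a
  have [measurable]: "g \<in> borel_measurable borel"
    unfolding g_def by measurable
  have "ennreal (norm h powr \<theta>) * indicator (annulus r) h = ennreal (r powr \<theta>) * g (h /\<^sub>R r)" for h
    using assms
    by (auto simp: g_def annulus_def indicator_def ennreal_mult[symmetric] powr_mult[symmetric]
        field_simps)
  then show ?thesis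
    using assms
    by (simp add: nn_integral_cmult nn_integral_levy_measure_scaleR_inverse g_def[symmetric]
        mult.assoc[symmetric] ennreal_mult[symmetric] powr_add[symmetric])
qed

lemma integrable_levy_measure_annuli:
  assumes s: "0 < s" "s powr (\<theta> - \<beta>) < 1"
  shows "integrable (levy_measure \<beta>)
    (\<lambda>h::'a::euclidean_space. norm h powr \<theta> * indicator (\<Union>k. annulus (s ^ k)) h)"
proof (rule integrableI_nonneg)
  let ?A = "\<lambda>k. annulus (s ^ k) :: 'a set"
  let ?M = "density (levy_measure \<beta>) (\<lambda>h::'a. ennreal (norm h powr \<theta>))"
  define m where "m = (\<integral>\<^sup>+h. ennreal (norm h powr \<theta>) * indicator (annulus 1) h
    \<partial>(levy_measure \<beta> :: 'a measure))"
  have emeasure_annulus: "emeasure ?M (?A k) = ennreal ((s powr (\<theta> - \<beta>)) ^ k) * m" for k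
  proof -
    have "(s ^ k) powr (\<theta> - \<beta>) = (s powr (\<theta> - \<beta>)) ^ k"
      using s by (simp add: powr_realpow[symmetric] powr_powr mult.commute)
    then show ?thesis
      using s by (simp add: emeasure_density nn_integral_levy_measure_annulus[of "s ^ k"] m_def)
  qed
  have "(\<integral>\<^sup>+h. ennreal (norm h powr \<theta> * indicator (\<Union>k. ?A k) h) \<partial>levy_measure \<beta>)
      = emeasure ?M (\<Union>k. ?A k)"
    by (subst emeasure_density) (auto intro!: nn_integral_cong simp: indicator_def)
  also have "\<dots> \<le> (\<Sum>k. emeasure ?M (?A k))"
    by (rule emeasure_subadditive_countably) auto
  also have "\<dots> = (\<Sum>k. ennreal ((s powr (\<theta> - \<beta>)) ^ k)) * m"
    by (simp only: emeasure_annulus ennreal_suminf_multc)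
  also have "\<dots> < \<infinity>"
  proof -
    have "(\<Sum>k. ennreal ((s powr (\<theta> - \<beta>)) ^ k)) < top"
      using s by (subst less_top[symmetric]) (intro ennreal_suminf_neq_top summable_geometric; simp)
    then show ?thesis
      using nn_integral_levy_measure_annulus_1[of \<beta> \<theta>, where 'a = 'a]
      by (simp add: ennreal_mult_less_top m_def)
  qed
  finally show "(\<integral>\<^sup>+h. ennreal (norm h powr \<theta> * indicator (\<Union>k. ?A k) h) \<partial>levy_measure \<beta>) < \<infinity>" .
qed auto

lemma integrable_levy_measure_tail:
  assumes "\<theta> < \<beta>"
  shows "integrable (levy_measure \<beta>)
    (\<lambda>h::'a::euclidean_space. norm h powr \<theta> * indicator {h. 1 \<le> norm h} h)"
proof -
  have "1 \<le> norm h" if "2 ^ k \<le> norm h" for h :: 'a and k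
    using one_le_power[of "2::real" k] that by linarith
  then have "{h::'a. 1 \<le> norm h} = (\<Union>k. annulus (2 ^ k))"
    unfolding annulus_def using ex_power_of_two_interval by blast
  then show ?thesis
    using assms powr_less_mono[of "\<theta> - \<beta>" 0 2]
      integrable_levy_measure_annuli[of 2 \<theta> \<beta>, where 'a = 'a] by simp
qed

lemma integrable_levy_measure_origin:
  assumes "\<beta> < \<theta>"
  shows "integrable (levy_measure \<beta>)
    (\<lambda>h::'a::euclidean_space. norm h powr \<theta> * indicator {h. norm h \<le> 1} h)"
proof (rule Bochner_Integration.integrable_bound)
  let ?U = "\<Union>k. annulus ((1 / 2) ^ k) :: 'a set"
  show "integrable (levy_measure \<beta>) (\<lambda>h. norm h powr \<theta> * indicator ?U h)"
    using assms powr_less_mono'[of "1 / 2" 0 "\<theta> - \<beta>"]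
    by (intro integrable_levy_measure_annuli) auto
  have "h \<in> ?U" if h: "h \<noteq> 0" "norm h \<le> 1" for h
  proof -
    have "1 \<le> 1 / norm h"
      using h by simp
    then obtain k where "2 ^ k \<le> 1 / norm h" "1 / norm h \<le> 2 * 2 ^ k"
      using ex_power_of_two_interval by blast
    then have "(1 / 2) ^ Suc k \<le> norm h" "norm h \<le> 2 * (1 / 2) ^ Suc k"
      using h by (simp_all add: field_simps)
    then show ?thesis
      unfolding annulus_def by blast
  qed
  then show "AE h in levy_measure \<beta>. norm (norm h powr \<theta> * indicator {h. norm h \<le> 1} h)
      \<le> norm (norm h powr \<theta> * indicator ?U h)"
    by (intro AE_I2) (auto simp: indicator_def)
qed auto

lemma integrable_levy_measureI:
  fixes f :: "'a::euclidean_space \<Rightarrow> real"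
  assumes f [measurable]: "f \<in> borel_measurable borel" and exponents: "\<beta> < a" "b < \<beta>"
    and origin: "\<And>h. norm h \<le> 1 \<Longrightarrow> \<bar>f h\<bar> \<le> A * norm h powr a"
    and tail: "\<And>h. 1 \<le> norm h \<Longrightarrow> \<bar>f h\<bar> \<le> B * norm h powr b"
  shows "integrable (levy_measure \<beta>) f"
proof (rule Bochner_Integration.integrable_bound)
  let ?g = "\<lambda>h. \<bar>A\<bar> * (norm h powr a * indicator {h. norm h \<le> 1} h)
    + \<bar>B\<bar> * (norm h powr b * indicator {h. 1 \<le> norm h} h)"
  show "integrable (levy_measure \<beta>) ?g"
    using exponents by (intro Bochner_Integration.integrable_add integrable_mult_right
        integrable_levy_measure_origin integrable_levy_measure_tail)
  have "\<bar>f h\<bar> \<le> ?g h" for h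
  proof (cases "norm h \<le> 1")
    case True
    have "\<bar>f h\<bar> \<le> \<bar>A\<bar> * norm h powr a"
      using origin[OF True] by (rule order_trans) (simp add: mult_right_mono)
    then show ?thesis
      using True by (simp add: add_increasing2)
  next
    case False
    then have "\<bar>f h\<bar> \<le> \<bar>B\<bar> * norm h powr b"
      by (intro order_trans[OF tail]) (simp_all add: mult_right_mono)
    then show ?thesis
      using False by simp
  qed
  then show "AE h in levy_measure \<beta>. norm (f h) \<le> norm (?g h)"
    by (intro AE_I2) (simp add: order_trans[OF _ abs_ge_self])
qed simp

lemma integrable_indicator_levy_measure_outside:
  assumes "0 < \<beta>" "0 < T"
  shows "integrable (levy_measure \<beta>) (indicator {h::'a::euclidean_space. T \<le> norm h} :: 'a \<Rightarrow> real)"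
proof (rule integrable_levy_measureI[where a = "\<beta> + 1" and b = 0])
  fix h :: 'a
  show "\<bar>indicator {h. T \<le> norm h} h\<bar> \<le> 1 / T powr (\<beta> + 1) * norm h powr (\<beta> + 1)"
    using assms by (auto simp: indicator_def powr_mono2)
  show "\<bar>indicator {h. T \<le> norm h} h\<bar> \<le> 1 * norm h powr 0" if "1 \<le> norm h"
    using that by (auto simp: indicator_def)
qed (use assms in auto)

lemma measure_levy_measure_outside_pos:
  assumes "0 < \<beta>" "0 < T"
  shows "0 < measure (levy_measure \<beta>) {h::'a::euclidean_space. T \<le> norm h}"
proof -
  let ?S = "{h::'a. T \<le> norm h}"
  have "?S \<notin> null_sets (levy_measure \<beta>)"
  proof
    assume "?S \<in> null_sets (levy_measure \<beta>)"
    then have "AE h in lborel. h \<in> ?S \<longrightarrow> ennreal (1 / norm h powr (real DIM('a) + \<beta>)) = 0"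
      unfolding levy_measure_def by (subst (asm) null_sets_density_iff) auto
    then have "AE h in lborel. h \<notin> ?S"
      by (rule AE_mp) (use assms in \<open>auto intro!: AE_I2\<close>)
    then have "?S \<in> null_sets lborel"
      by (subst AE_iff_null_sets) auto
    then have "negligible ?S"
      by (simp add: negligible_iff_null_sets null_sets_completionI)
    then have "negligible {h::'a. T < norm h}"
      by (rule negligible_subset) auto
    moreover have "open {h::'a. T < norm h}"
      by (intro open_Collect_less continuous_intros)
    moreover obtain h :: 'a where "norm h = T + 1"
      using vector_choose_size[of "T + 1"] assms by auto
    then have "h \<in> {h. T < norm h}"
      by simp
    ultimately show False
      using open_not_negligible by blast
  qed
  moreover have "emeasure (levy_measure \<beta>) ?S = ennreal (measure (levy_measure \<beta>) ?S)"
    using integrable_indicator_levy_measure_outside[OF assms, where 'a = 'a]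
    by (intro emeasure_eq_ennreal_measure) (simp add: integrable_indicator_iff less_top)
  ultimately show ?thesis
    by (auto simp: null_sets_def zero_less_measure_iff)
qed

subsection \<open>Interaction of scales\<close>

lemma integrable_trunc_norm_mult:
  fixes a b \<beta> :: real
  assumes "0 < \<beta>" "\<beta> < 2" "0 < a" "0 < b"
  shows "integrable (levy_measure \<beta>)
    (\<lambda>h::'a::euclidean_space. trunc_norm (h /\<^sub>R a) * trunc_norm (h /\<^sub>R b))"
proof (rule integrable_levy_measureI[where a = 2 and b = 0])
  fix h :: 'a
  have "trunc_norm (h /\<^sub>R a) * trunc_norm (h /\<^sub>R b) \<le> norm (h /\<^sub>R a) * norm (h /\<^sub>R b)"
    by (intro mult_mono trunc_norm_le_norm trunc_norm_nonneg norm_ge_zero)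
  then show "\<bar>trunc_norm (h /\<^sub>R a) * trunc_norm (h /\<^sub>R b)\<bar> \<le> 1 / (a * b) * norm h powr 2"
    using assms by (simp add: trunc_norm_nonneg power2_eq_square field_simps)
  show "\<bar>trunc_norm (h /\<^sub>R a) * trunc_norm (h /\<^sub>R b)\<bar> \<le> 1 * norm h powr 0" if "1 \<le> norm h"
    using that by (auto simp: trunc_norm_nonneg trunc_norm_le_1 mult_le_one)
qed (use assms in auto)

lemma integrable_trunc_norm_square:
  assumes "0 < \<beta>" "\<beta> < 2"
  shows "integrable (levy_measure \<beta>) (\<lambda>h::'a::euclidean_space. (trunc_norm h)\<^sup>2)"
  using integrable_trunc_norm_mult[of \<beta> 1 1, where 'a = 'a] assms by (simp add: power2_eq_square)

lemma integrable_trunc_norm_powr: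
  assumes "\<beta> - 1 < \<theta>" "\<theta> < \<beta>"
  shows "integrable (levy_measure \<beta>) (\<lambda>h::'a::euclidean_space. trunc_norm h * norm h powr \<theta>)"
proof (rule integrable_levy_measureI[where a = "1 + \<theta>" and b = \<theta>])
  fix h :: 'a
  show "\<bar>trunc_norm h * norm h powr \<theta>\<bar> \<le> 1 * norm h powr (1 + \<theta>)" if "norm h \<le> 1"
    using that by (simp add: trunc_norm_def powr_add)
  show "\<bar>trunc_norm h * norm h powr \<theta>\<bar> \<le> 1 * norm h powr \<theta>"
    by (simp add: trunc_norm_nonneg trunc_norm_le_1 mult_left_le_one_le)
qed (use assms in auto)

definition scale_overlap :: "'a::real_normed_vector measure \<Rightarrow> real \<Rightarrow> real \<Rightarrow> real" where
  "scale_overlap M a b = (LINT h|M. trunc_norm (h /\<^sub>R a) * trunc_norm (h /\<^sub>R b))"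

lemma scale_overlap_nonneg: "0 \<le> scale_overlap M a b"
  unfolding scale_overlap_def
  by (intro Bochner_Integration.integral_nonneg mult_nonneg_nonneg trunc_norm_nonneg)

lemma scale_overlap_commute: "scale_overlap M a b = scale_overlap M b a"
  by (simp add: scale_overlap_def mult.commute)

lemma scale_overlap_levy_measure_le:
  fixes a b \<beta> \<theta> :: real
  assumes \<beta>: "0 < \<beta>" "\<beta> < 2" and \<theta>: "\<beta> - 1 < \<theta>" "\<theta> < \<beta>" "0 \<le> \<theta>" "\<theta> \<le> 1"
    and a: "0 < a" and b: "0 < b"
  shows "scale_overlap (levy_measure \<beta> :: 'a::euclidean_space measure) a b
    \<le> a powr - \<beta> * (a / b) powr \<theta>
      * (LINT h|levy_measure \<beta>. trunc_norm h * norm (h::'a) powr \<theta>)"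
proof -
  let ?f = "\<lambda>h::'a. trunc_norm h * norm h powr \<theta>"
  note f_int = integrable_trunc_norm_powr[OF \<theta>(1,2), where 'a = 'a]
  have pointwise: "trunc_norm (h /\<^sub>R a) * trunc_norm (h /\<^sub>R b) \<le> (a / b) powr \<theta> * ?f (h /\<^sub>R a)"
    for h :: 'a
  proof -
    have "trunc_norm (h /\<^sub>R b) \<le> norm (h /\<^sub>R b) powr \<theta>"
      by (rule trunc_norm_le_powr[OF \<theta>(3,4)])
    also have "norm (h /\<^sub>R b) = a / b * norm (h /\<^sub>R a)"
      using a b by (simp add: field_simps)
    finally have "trunc_norm (h /\<^sub>R b) \<le> (a / b) powr \<theta> * norm (h /\<^sub>R a) powr \<theta>"
      by (simp only: powr_mult)
    from mult_left_mono[OF this trunc_norm_nonneg[of "h /\<^sub>R a"]] show ?thesis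
      by (simp only: mult_ac)
  qed
  have "scale_overlap (levy_measure \<beta> :: 'a measure) a b
      \<le> (LINT h|levy_measure \<beta>. (a / b) powr \<theta> * ?f (h /\<^sub>R a))"
    unfolding scale_overlap_def
    by (rule integral_mono[OF integrable_trunc_norm_mult[OF \<beta> a b]
          integrable_mult_right[OF integrable_levy_measure_scaleR_inverse[OF a f_int]] pointwise])
  also have "\<dots> = a powr - \<beta> * (a / b) powr \<theta> * (LINT h|levy_measure \<beta>. ?f h)"
    unfolding integral_mult_right_zero integral_levy_measure_scaleR_inverse[OF a f_int] by simp
  finally show ?thesis .
qed

definition scale_interaction :: "real \<Rightarrow> 'a::real_normed_vector measure \<Rightarrow> real \<Rightarrow> real \<Rightarrow> real" where
  "scale_interaction \<beta> M a b = a powr \<beta> * b powr \<beta> * (scale_overlap M a b)\<^sup>2"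

lemma scale_interaction_commute: "scale_interaction \<beta> M a b = scale_interaction \<beta> M b a"
  unfolding scale_interaction_def by (subst scale_overlap_commute) simp

lemma scale_interaction_levy_measure_le:
  fixes a b \<beta> \<theta> :: real
  assumes \<beta>: "0 < \<beta>" "\<beta> < 2" and \<theta>: "\<beta> - 1 < \<theta>" "\<theta> < \<beta>" "0 \<le> \<theta>" "\<theta> \<le> 1"
    and a: "0 < a" and b: "0 < b"
  shows "scale_interaction \<beta> (levy_measure \<beta> :: 'a::euclidean_space measure) a b
    \<le> (LINT h|levy_measure \<beta>. trunc_norm h * norm (h::'a) powr \<theta>)\<^sup>2 * (a / b) powr (2 * \<theta> - \<beta>)"
proof -
  let ?J = "scale_overlap (levy_measure \<beta> :: 'a measure) a b"
  let ?I = "LINT h|levy_measure \<beta>. trunc_norm h * norm (h::'a) powr \<theta>"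
  have "?J\<^sup>2 \<le> (a powr - \<beta> * (a / b) powr \<theta> * ?I)\<^sup>2"
    by (intro power_mono scale_overlap_levy_measure_le scale_overlap_nonneg assms)
  then have "a powr \<beta> * b powr \<beta> * ?J\<^sup>2
      \<le> a powr \<beta> * b powr \<beta> * (a powr - \<beta> * (a / b) powr \<theta> * ?I)\<^sup>2"
    by (intro mult_left_mono) auto
  also have "\<dots> = ?I\<^sup>2 * (a / b) powr (2 * \<theta> - \<beta>)"
  proof -
    have "(a / b) powr (2 * \<theta> - \<beta>) = ((a / b) powr \<theta>)\<^sup>2 / (a / b) powr \<beta>"
      by (simp only: powr_diff mult_2 powr_add power2_eq_square)
    also have "(a / b) powr \<beta> = a powr \<beta> / b powr \<beta>"
      by (rule powr_divide)
    finally show ?thesis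
      using a b by (simp add: powr_minus power_mult_distrib power2_eq_square field_simps)
  qed
  finally show ?thesis
    unfolding scale_interaction_def .
qed

lemma scale_interaction_levy_measure_decay:
  assumes \<beta>: "0 < \<beta>" "\<beta> < 2"
  shows "\<exists>A\<ge>0. \<exists>\<delta>>0. \<forall>a>0. \<forall>b>0.
    scale_interaction \<beta> (levy_measure \<beta> :: 'a::euclidean_space measure) a b
      \<le> A * (min a b / max a b) powr \<delta>"
proof -
  \<comment> \<open>Any exponent strictly between \<open>\<beta> / 2\<close> (decay) and \<open>min 1 \<beta>\<close> (integrability) works.\<close>
  define \<theta> where "\<theta> = (\<beta> / 2 + min 1 \<beta>) / 2"
  have \<theta>: "\<beta> - 1 < \<theta>" "\<theta> < \<beta>" "0 \<le> \<theta>" "\<theta> \<le> 1" "0 < 2 * \<theta> - \<beta>"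
    using \<beta> unfolding \<theta>_def by (auto simp: min_def field_simps)
  let ?E = "scale_interaction \<beta> (levy_measure \<beta> :: 'a measure)"
  let ?A = "(LINT h|levy_measure \<beta>. trunc_norm h * norm (h::'a) powr \<theta>)\<^sup>2"
  have "?E a b \<le> ?A * (min a b / max a b) powr (2 * \<theta> - \<beta>)" if "0 < a" "0 < b" for a b
    using scale_interaction_levy_measure_le[OF \<beta> \<theta>(1-4) that, where 'a = 'a]
      scale_interaction_levy_measure_le[OF \<beta> \<theta>(1-4) that(2,1), where 'a = 'a]
      scale_interaction_commute[of \<beta> "levy_measure \<beta> :: 'a measure" a b]
    by (cases "a \<le> b") (simp_all add: min_def max_def)
  then show ?thesis
    using \<theta>(5) zero_le_power2 by blast
qed

lemma sum_power_inj_le: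
  fixes q :: real
  assumes "0 \<le> q" "q < 1" "finite S" "inj_on f S"
  shows "(\<Sum>i\<in>S. q ^ f i) \<le> 1 / (1 - q)"
proof -
  have "(\<Sum>i\<in>S. q ^ f i) = (\<Sum>m\<in>f ` S. q ^ m)"
    using assms(4) by (simp add: sum.reindex)
  also have "\<dots> \<le> (\<Sum>m. q ^ m)"
    using assms by (intro sum_le_suminf summable_geometric) auto
  finally show ?thesis
    using assms by (simp add: suminf_geometric)
qed

lemma sum_power_abs_diff_le:
  fixes q :: real
  assumes q: "0 \<le> q" "q < 1"
  shows "(\<Sum>k<K. q ^ nat \<bar>int j - int k\<bar>) \<le> 2 / (1 - q)"
proof -
  have "(\<Sum>k<K. q ^ nat \<bar>int j - int k\<bar>)
      = (\<Sum>k\<in>{..<K} \<inter> {..j}. q ^ nat \<bar>int j - int k\<bar>)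
        + (\<Sum>k\<in>{..<K} - {..j}. q ^ nat \<bar>int j - int k\<bar>)"
    by (rule sum.Int_Diff) simp
  also have "\<dots> \<le> 1 / (1 - q) + 1 / (1 - q)"
    by (intro add_mono sum_power_inj_le q) (auto simp: inj_on_def)
  finally show ?thesis by simp
qed

lemma powr_min_div_max_dyadic:
  fixes R \<delta> :: real
  assumes "0 < R"
  shows "(min (R * 2 ^ j) (R * 2 ^ k) / max (R * 2 ^ j) (R * 2 ^ k)) powr \<delta>
    = ((1 / 2) powr \<delta>) ^ nat \<bar>int j - int k\<bar>"
proof -
  have "min (R * 2 ^ j) (R * 2 ^ k) / max (R * 2 ^ j) (R * 2 ^ k) = (1 / 2) ^ nat \<bar>int j - int k\<bar>"
  proof (induction j k rule: linorder_wlog)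
    case (le j k)
    then have "R * 2 ^ j \<le> R * 2 ^ k"
      using assms by simp
    then show ?case
      using le assms by (simp add: min_def max_def power_divide power_diff nat_diff_distrib)
  next
    case (sym j k)
    then show ?case
      by (simp add: min.commute max.commute abs_minus_commute)
  qed
  then show ?thesis
    by (simp add: powr_realpow[symmetric] powr_powr mult.commute)
qed

lemma sum_scale_interaction_dyadic_le:
  assumes \<beta>: "0 < \<beta>" "\<beta> < 2" and R: "0 < R"
  shows "\<exists>A. \<forall>K. (\<Sum>j<K. \<Sum>k<K.
      scale_interaction \<beta> (levy_measure \<beta> :: 'a::euclidean_space measure) (R * 2 ^ j) (R * 2 ^ k))
    \<le> A * real K"
proof -
  let ?E = "\<lambda>j k. scale_interaction \<beta> (levy_measure \<beta> :: 'a measure) (R * 2 ^ j) (R * 2 ^ k)"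
  obtain A \<delta> where A: "0 \<le> A" and \<delta>: "0 < \<delta>"
    and decay: "\<And>a b. 0 < a \<Longrightarrow> 0 < b \<Longrightarrow> scale_interaction \<beta> (levy_measure \<beta> :: 'a measure) a b
      \<le> A * (min a b / max a b) powr \<delta>"
    using scale_interaction_levy_measure_decay[OF \<beta>, where 'a = 'a] by blast
  define q where "q = (1 / 2 :: real) powr \<delta>"
  have q: "0 \<le> q" "q < 1"
    using \<delta> powr_less_mono'[of "1 / 2" 0 \<delta>] by (auto simp: q_def)
  have E_le: "?E j k \<le> A * q ^ nat \<bar>int j - int k\<bar>" for j k
    using decay[of "R * 2 ^ j" "R * 2 ^ k"] R by (simp add: powr_min_div_max_dyadic q_def)
  have row: "(\<Sum>k<K. ?E j k) \<le> A * (2 / (1 - q))" for j K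
  proof -
    have "(\<Sum>k<K. ?E j k) \<le> A * (\<Sum>k<K. q ^ nat \<bar>int j - int k\<bar>)"
      unfolding sum_distrib_left by (intro sum_mono E_le)
    also have "\<dots> \<le> A * (2 / (1 - q))"
      by (intro mult_left_mono sum_power_abs_diff_le q A)
    finally show ?thesis .
  qed
  have "(\<Sum>j<K. \<Sum>k<K. ?E j k) \<le> A * (2 / (1 - q)) * real K" for K
    using sum_bounded_above[of "{..<K}" "\<lambda>j. \<Sum>k<K. ?E j k", OF row] by (simp add: mult.commute)
  then show ?thesis by blast
qed

subsection \<open>The operators in terms of mixed differences\<close>

lemma c_const_pos:
  assumes "0 < \<beta>" "\<beta> < 2"
  shows "0 < c_const \<beta> d"
proof -
  have "- \<beta> / 2 \<notin> \<int>\<^sub>\<le>\<^sub>0"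
  proof
    assume "- \<beta> / 2 \<in> \<int>\<^sub>\<le>\<^sub>0"
    then obtain n :: int where "- \<beta> / 2 = of_int n"
      by (auto simp: nonpos_Ints_def)
    then have "- 1 < real_of_int n" "real_of_int n < 0"
      using assms by linarith+
    then show False
      by simp
  qed
  then have "Gamma (- \<beta> / 2) \<noteq> 0"
    by (simp add: Gamma_eq_zero_iff)
  moreover have "Gamma ((real d + \<beta>) / 2) > 0"
    using assms by (intro Gamma_real_pos) auto
  ultimately show ?thesis
    unfolding c_const_def by simp
qed

lemma (in pair_sigma_finite)
  fixes f :: "'a \<Rightarrow> real" and g :: "'b \<Rightarrow> real"
  assumes f: "integrable M1 f" and g: "integrable M2 g"
  shows integrable_pair_mult: "integrable (M1 \<Otimes>\<^sub>M M2) (\<lambda>(x, y). f x * g y)"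
    and integral_pair_mult:
      "(LINT (x, y)|(M1 \<Otimes>\<^sub>M M2). f x * g y) = (LINT x|M1. f x) * (LINT y|M2. g y)"
proof -
  have [measurable]: "f \<in> borel_measurable M1" "g \<in> borel_measurable M2"
    using f g by auto
  show "integrable (M1 \<Otimes>\<^sub>M M2) (\<lambda>(x, y). f x * g y)"
    using f g by (intro Fubini_integrable) (auto simp: abs_mult)
  from integral_fst[OF this]
  show "(LINT (x, y)|(M1 \<Otimes>\<^sub>M M2). f x * g y) = (LINT x|M1. f x) * (LINT y|M2. g y)"
    by simp
qed

lemma fracL_eq_integral_levy_measure:
  fixes u :: "real^'n \<Rightarrow> real"
  assumes [measurable]: "u \<in> borel_measurable borel"
  shows "fracL \<beta> u x = - c_const \<beta> CARD('n) * (LINT h|levy_measure \<beta>. mixed_difference u x h (- h))"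
proof -
  let ?k = "\<lambda>h::real^'n. norm h powr (real CARD('n) + \<beta>)"
  have "(u (x + h) - 2 * u x + u (x - h)) / ?k h = - (mixed_difference u x h (- h) / ?k h)" for h
    by (simp add: mixed_difference_minus add_divide_distrib diff_divide_distrib)
  then have "fracL \<beta> u x
      = - c_const \<beta> CARD('n) * (LINT h|lborel. mixed_difference u x h (- h) / ?k h)"
    by (simp add: fracL_def)
  also have "(LINT h|lborel. mixed_difference u x h (- h) / ?k h)
      = (LINT h|levy_measure \<beta>. mixed_difference u x h (- h))"
    by (subst integral_levy_measure) (auto simp: mixed_difference_def)
  finally show ?thesis .
qed

lemma integrable_mixed_difference_minus:
  fixes u :: "'a::euclidean_space \<Rightarrow> real"
  assumes \<beta>: "0 < \<beta>" "\<beta> < 2" and u: "smooth u" "compact_support u"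
  shows "integrable (levy_measure \<beta>) (\<lambda>h. mixed_difference u x h (- h))"
proof -
  obtain C where C: "\<And>h s. \<bar>mixed_difference u x h s\<bar> \<le> C * (trunc_norm h * trunc_norm s)"
    using smooth_abs_mixed_difference_le[OF u] by blast
  have [measurable]: "u \<in> borel_measurable borel"
    by (rule smooth_imp_borel_measurable[OF u(1)])
  have "integrable (levy_measure \<beta>) (\<lambda>h::'a. C * (trunc_norm h)\<^sup>2)"
    by (intro integrable_mult_right integrable_trunc_norm_square \<beta>)
  then show ?thesis
  proof (rule Bochner_Integration.integrable_bound)
    show "AE h in levy_measure \<beta>. norm (mixed_difference u x h (- h)) \<le> norm (C * (trunc_norm h)\<^sup>2)"
      using C[of _ "- _"]
      by (intro AE_I2) (simp add: trunc_norm_minus power2_eq_square order_trans[OF _ abs_ge_self])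
  qed (simp add: mixed_difference_def)
qed

lemma integrable_mixed_difference_square:
  fixes u :: "'a::euclidean_space \<Rightarrow> real"
  assumes \<beta>: "0 < \<beta>" "\<beta> < 2" and u: "smooth u" "compact_support u"
  shows "integrable (levy_measure \<beta> \<Otimes>\<^sub>M levy_measure \<beta>) (\<lambda>(h, s). (mixed_difference u x h s)\<^sup>2)"
proof -
  interpret pair_sigma_finite "levy_measure \<beta> :: 'a measure" "levy_measure \<beta> :: 'a measure"
    by (rule pair_sigma_finite_levy_measure)
  obtain C where C: "\<And>h s. \<bar>mixed_difference u x h s\<bar> \<le> C * (trunc_norm h * trunc_norm s)"
    using smooth_abs_mixed_difference_le[OF u] by blast
  have [measurable]: "u \<in> borel_measurable borel"
    by (rule smooth_imp_borel_measurable[OF u(1)])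
  note trunc_int = integrable_trunc_norm_square[OF \<beta>, where 'a = 'a]
  from integrable_mult_right[OF integrable_pair_mult[OF trunc_int trunc_int], of "C\<^sup>2"]
  show ?thesis
  proof (rule Bochner_Integration.integrable_bound)
    have "(mixed_difference u x h s)\<^sup>2 \<le> (C * (trunc_norm h * trunc_norm s))\<^sup>2" for h s
      using C[of h s] by (intro power2_le_iff_abs_le[THEN iffD2]) auto
    then show "AE p in levy_measure \<beta> \<Otimes>\<^sub>M levy_measure \<beta>.
        norm (case p of (h, s) \<Rightarrow> (mixed_difference u x h s)\<^sup>2)
        \<le> norm (C\<^sup>2 * (case p of (h, s) \<Rightarrow> (trunc_norm h)\<^sup>2 * (trunc_norm s)\<^sup>2))"
      by (intro AE_I2) (auto simp: power_mult_distrib abs_mult)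
  qed (simp add: mixed_difference_def)
qed

lemma Gamma2_eq_integral_levy_measure:
  fixes u :: "real^'n \<Rightarrow> real"
  assumes \<beta>: "0 < \<beta>" "\<beta> < 2" and u: "smooth u" "compact_support u"
  shows "Gamma2 \<beta> u x = (c_const \<beta> CARD('n))\<^sup>2
    * (LINT (h, s)|(levy_measure \<beta> \<Otimes>\<^sub>M levy_measure \<beta>). (mixed_difference u x h s)\<^sup>2)"
proof -
  interpret pair_sigma_finite
    "levy_measure \<beta> :: (real^'n) measure" "levy_measure \<beta> :: (real^'n) measure"
    by (rule pair_sigma_finite_levy_measure)
  have [measurable]: "u \<in> borel_measurable borel"
    by (rule smooth_imp_borel_measurable[OF u(1)])
  let ?k = "\<lambda>h::real^'n. norm h powr (real CARD('n) + \<beta>)"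
  have "(LINT (h, s)|(levy_measure \<beta> \<Otimes>\<^sub>M levy_measure \<beta>). (mixed_difference u x h s)\<^sup>2)
      = (LINT h|levy_measure \<beta>. LINT s|levy_measure \<beta>. (mixed_difference u x h s)\<^sup>2)"
    by (rule integral_fst[OF integrable_mixed_difference_square[OF assms], symmetric])
  also have "\<dots> = (LINT h|lborel. (LINT s|levy_measure \<beta>. (mixed_difference u x h s)\<^sup>2) / ?k h)"
    by (subst integral_levy_measure) (auto simp: mixed_difference_def)
  also have "\<dots> = (LINT h|lborel. LINT s|lborel. (mixed_difference u x h s)\<^sup>2 / (?k h * ?k s))"
    by (subst integral_levy_measure) (auto simp: mixed_difference_def mult.commute
        simp flip: integral_divide_zero)
  finally show ?thesis
    by (simp add: Gamma2_def mixed_difference_def)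
qed

lemma mixed_difference_square_ge:
  fixes u :: "'a::real_normed_vector \<Rightarrow> real"
  assumes vanish: "\<And>y. T < norm y \<Longrightarrow> u y = 0" and nonneg: "\<And>y. 0 \<le> u y"
    and far: "T + norm x < norm h" "T + norm x < norm s"
  shows "(u x)\<^sup>2 \<le> (mixed_difference u x h s)\<^sup>2"
proof -
  have "u (x + y) = 0" if "T + norm x < norm y" for y
    using that norm_triangle_ineq2[of y "- x"] by (intro vanish) (simp add: add.commute)
  then have "mixed_difference u x h s = u (x + h + s) + u x"
    using far by (simp add: mixed_difference_def)
  then show ?thesis
    using nonneg by (simp add: power_mono)
qed

lemma Gamma2_pos:
  fixes u :: "real^'n \<Rightarrow> real"
  assumes \<beta>: "0 < \<beta>" "\<beta> < 2" and u: "smooth u" "compact_support u" "\<And>y. 0 \<le> u y" "0 < u x"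
  shows "0 < Gamma2 \<beta> u x"
proof -
  interpret pair_sigma_finite
    "levy_measure \<beta> :: (real^'n) measure" "levy_measure \<beta> :: (real^'n) measure"
    by (rule pair_sigma_finite_levy_measure)
  obtain T where T: "\<And>y. T < norm y \<Longrightarrow> u y = 0"
    using u(2) unfolding compact_support_iff by blast
  define S where "S = {h::real^'n. \<bar>T\<bar> + norm x + 1 \<le> norm h}"
  have "0 < \<bar>T\<bar> + norm x + 1"
    by (intro add_nonneg_pos) auto
  then have S_pos: "0 < measure (levy_measure \<beta>) S"
    and S_int: "integrable (levy_measure \<beta>) (indicator S :: real^'n \<Rightarrow> real)"
    unfolding S_def using \<beta>(1)
    by (auto intro: measure_levy_measure_outside_pos integrable_indicator_levy_measure_outside)
  have lower: "(u x)\<^sup>2 * (indicator S h * indicator S s) \<le> (mixed_difference u x h s)\<^sup>2" for h s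
    using mixed_difference_square_ge[of T u x h s] T u(3) by (auto simp: S_def indicator_def)
  have "0 < (u x)\<^sup>2 * (measure (levy_measure \<beta>) S * measure (levy_measure \<beta>) S)"
    using S_pos u(4) by simp
  also have "\<dots> = (LINT (h, s)|(levy_measure \<beta> \<Otimes>\<^sub>M levy_measure \<beta>).
      (u x)\<^sup>2 * (indicator S h * indicator S s))"
    using integral_pair_mult[OF S_int S_int] by (simp add: case_prod_unfold)
  also have "\<dots> \<le> (LINT (h, s)|(levy_measure \<beta> \<Otimes>\<^sub>M levy_measure \<beta>). (mixed_difference u x h s)\<^sup>2)"
    using integrable_pair_mult[OF S_int S_int] lower
    by (intro integral_mono integrable_mixed_difference_square \<beta> u(1,2))
      (auto simp: case_prod_unfold)
  finally show ?thesis
    using c_const_pos[OF \<beta>, of "CARD('n)"]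
    by (simp add: Gamma2_eq_integral_levy_measure[OF \<beta> u(1,2)])
qed

subsection \<open>Superpositions of dilates\<close>

definition multiscale :: "real \<Rightarrow> (nat \<Rightarrow> real) \<Rightarrow> ('a::real_vector \<Rightarrow> real) \<Rightarrow> nat \<Rightarrow> 'a \<Rightarrow> real" where
  "multiscale \<beta> r \<phi> K x = (\<Sum>k<K. r k powr \<beta> * \<phi> (x /\<^sub>R r k))"

lemma smooth_multiscale: "smooth \<phi> \<Longrightarrow> smooth (multiscale \<beta> r \<phi> K)"
  unfolding multiscale_def[abs_def]
  by (intro smooth_sum smooth_mult smooth_const smooth_compose_scaleR) auto

lemma multiscale_nonneg: "(\<And>x. 0 \<le> \<phi> x) \<Longrightarrow> 0 \<le> multiscale \<beta> r \<phi> K x"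
  unfolding multiscale_def by (intro sum_nonneg mult_nonneg_nonneg) auto

lemma compact_support_multiscale:
  assumes r: "\<And>k. 0 < r k" and \<phi>: "compact_support \<phi>"
  shows "compact_support (multiscale \<beta> r \<phi> K)"
proof -
  obtain T where T: "\<And>x. T < norm x \<Longrightarrow> \<phi> x = 0"
    using \<phi> unfolding compact_support_iff by blast
  have "multiscale \<beta> r \<phi> K x = 0" if x: "(\<Sum>k<K. \<bar>T\<bar> * r k) < norm x" for x
    unfolding multiscale_def
  proof (intro sum.neutral ballI)
    fix k assume "k \<in> {..<K}"
    then have "\<bar>T\<bar> * r k \<le> (\<Sum>k<K. \<bar>T\<bar> * r k)"
      using r by (intro member_le_sum) (auto simp: less_imp_le)
    then have "\<bar>T\<bar> * r k < norm x"
      using x by linarith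
    then have "T < norm (x /\<^sub>R r k)"
      using r[of k] by (simp add: field_simps abs_less_iff) (smt (verit) mult_right_mono)
    then show "r k powr \<beta> * \<phi> (x /\<^sub>R r k) = 0"
      by (simp add: T)
  qed
  then show ?thesis
    unfolding compact_support_iff by blast
qed

lemma mixed_difference_multiscale:
  "mixed_difference (multiscale \<beta> r \<phi> K) x h s
    = (\<Sum>k<K. r k powr \<beta> * mixed_difference \<phi> (x /\<^sub>R r k) (h /\<^sub>R r k) (s /\<^sub>R r k))"
  by (simp add: mixed_difference_def multiscale_def scaleR_add_right ring_distribs
      sum.distrib sum_subtractf)

lemma fracL_multiscale:
  fixes \<phi> :: "real^'n \<Rightarrow> real"
  assumes \<beta>: "0 < \<beta>" "\<beta> < 2" and \<phi>: "smooth \<phi>" "compact_support \<phi>" and r: "\<And>k. 0 < r k"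
  shows "fracL \<beta> (multiscale \<beta> r \<phi> K) x = (\<Sum>k<K. fracL \<beta> \<phi> (x /\<^sub>R r k))"
proof -
  define f where "f k h = mixed_difference \<phi> (x /\<^sub>R r k) h (- h)" for k h
  have f_int: "integrable (levy_measure \<beta>) (f k)" for k
    unfolding f_def by (rule integrable_mixed_difference_minus[OF \<beta> \<phi>])
  have "(LINT h|levy_measure \<beta>. mixed_difference (multiscale \<beta> r \<phi> K) x h (- h))
      = (LINT h|levy_measure \<beta>. (\<Sum>k<K. r k powr \<beta> * f k (h /\<^sub>R r k)))"
    by (simp add: mixed_difference_multiscale f_def)
  also have "\<dots> = (\<Sum>k<K. r k powr \<beta> * (LINT h|levy_measure \<beta>. f k (h /\<^sub>R r k)))"
    using integrable_levy_measure_scaleR_inverse[OF r f_int]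
    by (subst Bochner_Integration.integral_sum) auto
  also have "\<dots> = (\<Sum>k<K. (LINT h|levy_measure \<beta>. f k h))"
  proof (intro sum.cong refl)
    show "r k powr \<beta> * (LINT h|levy_measure \<beta>. f k (h /\<^sub>R r k)) = (LINT h|levy_measure \<beta>. f k h)"
      for k
      using r[of k] by (simp add: integral_levy_measure_scaleR_inverse[OF r f_int] powr_minus)
  qed
  finally show ?thesis
    using \<phi>(1) by (simp add: fracL_eq_integral_levy_measure smooth_imp_borel_measurable
        smooth_multiscale sum_distrib_left f_def sum_negf)
qed

lemma mixed_difference_multiscale_square_le:
  assumes C: "\<And>x h s. \<bar>mixed_difference \<phi> x h s\<bar> \<le> C * (trunc_norm h * trunc_norm s)"
  shows "(mixed_difference (multiscale \<beta> r \<phi> K) x h s)\<^sup>2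
    \<le> (\<Sum>j<K. \<Sum>k<K. C\<^sup>2 * (r j powr \<beta> * r k powr \<beta>)
      * ((trunc_norm (h /\<^sub>R r j) * trunc_norm (h /\<^sub>R r k))
        * (trunc_norm (s /\<^sub>R r j) * trunc_norm (s /\<^sub>R r k))))"
proof -
  let ?D = "\<lambda>k. mixed_difference \<phi> (x /\<^sub>R r k) (h /\<^sub>R r k) (s /\<^sub>R r k)"
  let ?t = "\<lambda>k. C * (trunc_norm (h /\<^sub>R r k) * trunc_norm (s /\<^sub>R r k))"
  have "\<bar>mixed_difference (multiscale \<beta> r \<phi> K) x h s\<bar> \<le> (\<Sum>k<K. \<bar>r k powr \<beta> * ?D k\<bar>)"
    unfolding mixed_difference_multiscale by (rule sum_abs)
  also have "\<dots> \<le> (\<Sum>k<K. r k powr \<beta> * ?t k)"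
    unfolding abs_mult by (intro sum_mono mult_mono C) auto
  finally have "(mixed_difference (multiscale \<beta> r \<phi> K) x h s)\<^sup>2 \<le> (\<Sum>k<K. r k powr \<beta> * ?t k)\<^sup>2"
    by (intro power2_le_iff_abs_le[THEN iffD2]) auto
  then show ?thesis
    by (simp add: power2_eq_square sum_product mult_ac)
qed

lemma integral_mixed_difference_multiscale_square_le:
  fixes \<phi> :: "'a::euclidean_space \<Rightarrow> real"
  assumes \<beta>: "0 < \<beta>" "\<beta> < 2" and \<phi>: "smooth \<phi>" "compact_support \<phi>" and r: "\<And>k. 0 < r k"
    and C: "\<And>x h s. \<bar>mixed_difference \<phi> x h s\<bar> \<le> C * (trunc_norm h * trunc_norm s)"
  shows "(LINT (h, s)|(levy_measure \<beta> \<Otimes>\<^sub>M levy_measure \<beta>).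
      (mixed_difference (multiscale \<beta> r \<phi> K) x h s)\<^sup>2)
    \<le> C\<^sup>2 * (\<Sum>j<K. \<Sum>k<K. scale_interaction \<beta> (levy_measure \<beta> :: 'a measure) (r j) (r k))"
proof -
  interpret pair_sigma_finite "levy_measure \<beta> :: 'a measure" "levy_measure \<beta> :: 'a measure"
    by (rule pair_sigma_finite_levy_measure)
  define g where "g j k h = trunc_norm (h /\<^sub>R r j) * trunc_norm (h /\<^sub>R r k)" for j k and h :: 'a
  define w where "w j k = C\<^sup>2 * (r j powr \<beta> * r k powr \<beta>)" for j k
  have g_int: "integrable (levy_measure \<beta>) (g j k)" for j k
    unfolding g_def by (rule integrable_trunc_norm_mult[OF \<beta> r r])
  note summand_int = integrable_mult_right[OF integrable_pair_mult[OF g_int g_int]]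
  have "(LINT (h, s)|(levy_measure \<beta> \<Otimes>\<^sub>M levy_measure \<beta>).
        (mixed_difference (multiscale \<beta> r \<phi> K) x h s)\<^sup>2)
      \<le> (LINT p|(levy_measure \<beta> \<Otimes>\<^sub>M levy_measure \<beta>).
          (\<Sum>j<K. \<Sum>k<K. w j k * (case p of (h, s) \<Rightarrow> g j k h * g j k s)))"
  proof (rule integral_mono)
    show "integrable (levy_measure \<beta> \<Otimes>\<^sub>M levy_measure \<beta>)
        (\<lambda>(h, s). (mixed_difference (multiscale \<beta> r \<phi> K) x h s)\<^sup>2)"
      by (intro integrable_mixed_difference_square \<beta> smooth_multiscale
          compact_support_multiscale r \<phi>)
    show "(case p of (h, s) \<Rightarrow> (mixed_difference (multiscale \<beta> r \<phi> K) x h s)\<^sup>2)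
        \<le> (\<Sum>j<K. \<Sum>k<K. w j k * (case p of (h, s) \<Rightarrow> g j k h * g j k s))" for p
      unfolding w_def g_def using mixed_difference_multiscale_square_le[OF C] by (cases p) simp
  qed (intro Bochner_Integration.integrable_sum summand_int)
  also have "\<dots> = (\<Sum>j<K. \<Sum>k<K. w j k * (LINT h|levy_measure \<beta>. g j k h)\<^sup>2)"
    using summand_int integral_pair_mult[OF g_int g_int]
    by (simp add: Bochner_Integration.integral_sum Bochner_Integration.integrable_sum
        power2_eq_square)
  finally show ?thesis
    by (simp add: w_def g_def scale_interaction_def scale_overlap_def sum_distrib_left mult.assoc)
qed

lemma Gamma2_multiscale_le:
  fixes \<phi> :: "real^'n \<Rightarrow> real"
  assumes \<beta>: "0 < \<beta>" "\<beta> < 2" and R: "0 < R" and \<phi>: "smooth \<phi>" "compact_support \<phi>"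
  shows "\<exists>B. \<forall>K x. Gamma2 \<beta> (multiscale \<beta> (\<lambda>k. R * 2 ^ k) \<phi> K) x \<le> B * real K"
proof -
  let ?c = "c_const \<beta> CARD('n)" and ?u = "multiscale \<beta> (\<lambda>k. R * 2 ^ k) \<phi>"
  have r: "0 < R * 2 ^ k" for k :: nat
    using R by simp
  obtain C where C: "\<And>x h s. \<bar>mixed_difference \<phi> x h s\<bar> \<le> C * (trunc_norm h * trunc_norm s)"
    using smooth_abs_mixed_difference_le[OF \<phi>] by blast
  obtain A where A: "\<And>K. (\<Sum>j<K. \<Sum>k<K.
      scale_interaction \<beta> (levy_measure \<beta> :: (real^'n) measure) (R * 2 ^ j) (R * 2 ^ k))
      \<le> A * real K"
    using sum_scale_interaction_dyadic_le[OF \<beta> R, where 'a = "real^'n"] by blast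
  have "Gamma2 \<beta> (?u K) x \<le> ?c\<^sup>2 * (C\<^sup>2 * A) * real K" for K x
  proof -
    have "(LINT (h, s)|(levy_measure \<beta> \<Otimes>\<^sub>M levy_measure \<beta>). (mixed_difference (?u K) x h s)\<^sup>2)
        \<le> C\<^sup>2 * (\<Sum>j<K. \<Sum>k<K.
          scale_interaction \<beta> (levy_measure \<beta> :: (real^'n) measure) (R * 2 ^ j) (R * 2 ^ k))"
      by (rule integral_mixed_difference_multiscale_square_le[OF \<beta> \<phi> r C])
    also have "\<dots> \<le> C\<^sup>2 * (A * real K)"
      by (intro mult_left_mono A) simp
    finally have "?c\<^sup>2 * (LINT (h, s)|(levy_measure \<beta> \<Otimes>\<^sub>M levy_measure \<beta>).
          (mixed_difference (?u K) x h s)\<^sup>2)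
        \<le> ?c\<^sup>2 * (C\<^sup>2 * (A * real K))"
      by (intro mult_left_mono) simp_all
    then show ?thesis
      unfolding Gamma2_eq_integral_levy_measure[OF \<beta> smooth_multiscale[OF \<phi>(1)]
          compact_support_multiscale[OF r \<phi>(2)]] by (simp only: mult.assoc)
  qed
  then show ?thesis by blast
qed

lemma cutoff_mixed_difference_ge:
  assumes x: "norm x \<le> 1"
  shows "2 * indicator {h. 3 \<le> norm h} h \<le> mixed_difference cutoff x h (- h)"
proof (cases "3 \<le> norm h")
  case True
  then have "2 \<le> norm (x + h)" "2 \<le> norm (x - h)"
    using x norm_triangle_ineq2[of h "- x"] norm_triangle_ineq2[of h x]
    by (simp_all add: add.commute norm_minus_commute)
  then show ?thesis
    using True x by (simp add: mixed_difference_minus cutoff_eq_0 cutoff_eq_1)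
next
  case False
  then show ?thesis
    using x cutoff_le_1[of "x + h"] cutoff_le_1[of "x - h"]
    by (simp add: mixed_difference_minus cutoff_eq_1)
qed

lemma fracL_cutoff_le:
  assumes \<beta>: "0 < \<beta>" "\<beta> < 2"
  shows "\<exists>A>0. \<forall>x::real^'n. norm x \<le> 1 \<longrightarrow> fracL \<beta> cutoff x \<le> - A"
proof (intro exI conjI allI impI)
  let ?S = "{h::real^'n. 3 \<le> norm h}"
  let ?A = "c_const \<beta> CARD('n) * (2 * measure (levy_measure \<beta>) ?S)"
  show "0 < ?A"
    using \<beta> by (intro mult_pos_pos c_const_pos measure_levy_measure_outside_pos) auto
  fix x :: "real^'n" assume x: "norm x \<le> 1"
  have "integrable (levy_measure \<beta>) (indicator ?S :: real^'n \<Rightarrow> real)"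
    using \<beta> by (intro integrable_indicator_levy_measure_outside) auto
  then have "(LINT h|levy_measure \<beta>. 2 * indicator ?S h)
      \<le> (LINT h|levy_measure \<beta>. mixed_difference cutoff x h (- h))"
    by (intro integral_mono integrable_mult_right integrable_mixed_difference_minus \<beta>
        smooth_cutoff compact_support_cutoff cutoff_mixed_difference_ge x)
  then have "2 * measure (levy_measure \<beta>) ?S
      \<le> (LINT h|levy_measure \<beta>. mixed_difference cutoff x h (- h))"
    by simp
  from mult_left_mono[OF this less_imp_le[OF c_const_pos[OF \<beta>]]]
  show "fracL \<beta> cutoff x \<le> - ?A"
    by (simp add: fracL_eq_integral_levy_measure smooth_imp_borel_measurable smooth_cutoff)
qed

lemma norm_inverse_scaleR_le_1: "0 < r \<Longrightarrow> norm x \<le> r \<Longrightarrow> norm (x /\<^sub>R r) \<le> 1"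
  by (simp add: field_simps)

lemma multiscale_cutoff_pos:
  assumes "\<And>k. 0 < r k" "\<And>k. norm x \<le> r k" "0 < K"
  shows "0 < multiscale \<beta> r cutoff K x"
  unfolding multiscale_def
proof (intro sum_pos)
  show "0 < r k powr \<beta> * cutoff (x /\<^sub>R r k)" for k
    using assms(1)[of k] by (simp add: cutoff_eq_1[OF norm_inverse_scaleR_le_1[OF assms(1,2)]])
qed (use assms in auto)

lemma abs_fracL_multiscale_cutoff_ge:
  assumes \<beta>: "0 < \<beta>" "\<beta> < 2"
  shows "\<exists>A>0. \<forall>r K. \<forall>x::real^'n. (\<forall>k. 0 < r k \<and> norm x \<le> r k) \<longrightarrow>
    A * real K \<le> \<bar>fracL \<beta> (multiscale \<beta> r cutoff K) x\<bar>"
proof -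
  obtain A where A: "0 < A" "\<And>x::real^'n. norm x \<le> 1 \<Longrightarrow> fracL \<beta> cutoff x \<le> - A"
    using fracL_cutoff_le[OF \<beta>] by blast
  have "A * real K \<le> \<bar>fracL \<beta> (multiscale \<beta> r cutoff K) x\<bar>"
    if r: "\<And>k. 0 < r k" "\<And>k. norm x \<le> r k" for r K and x :: "real^'n"
  proof -
    have "fracL \<beta> (multiscale \<beta> r cutoff K) x = (\<Sum>k<K. fracL \<beta> cutoff (x /\<^sub>R r k))"
      by (rule fracL_multiscale[OF \<beta> smooth_cutoff compact_support_cutoff r(1)])
    also have "\<dots> \<le> (\<Sum>k<K. - A)"
      by (intro sum_mono A(2) norm_inverse_scaleR_le_1 r)
    finally show ?thesis
      by (simp add: mult.commute)
  qed
  then show ?thesis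
    using A(1) by blast
qed

theorem theorem3p7:
  fixes \<beta> R \<mu> :: real
  assumes "0 < \<beta>" and "\<beta> < 2" and "0 < R" and "0 < \<mu>"
  shows "\<exists>u :: real^'n \<Rightarrow> real. smooth u \<and> compact_support u \<and>
           (\<forall>x. norm x \<le> R \<longrightarrow>
              0 < Gamma2 \<beta> u x \<and> Gamma2 \<beta> u x < \<mu> * (fracL \<beta> u x)\<^sup>2)"
proof -
  let ?u = "multiscale \<beta> (\<lambda>k. R * 2 ^ k) cutoff :: nat \<Rightarrow> real^'n \<Rightarrow> real"
  have R: "0 < R * 2 ^ k" "R \<le> R * 2 ^ k" for k :: nat
    using assms(3) by (auto simp: mult_le_cancel_left1)
  obtain A where A: "0 < A" "\<And>K x. norm x \<le> R \<Longrightarrow> A * real K \<le> \<bar>fracL \<beta> (?u K) x\<bar>"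
    using abs_fracL_multiscale_cutoff_ge[OF assms(1,2), where 'n = 'n] R order_trans by metis
  obtain B where B: "\<And>K x. Gamma2 \<beta> (?u K) x \<le> B * real K"
    using Gamma2_multiscale_le[OF assms(1-3) smooth_cutoff compact_support_cutoff] by blast
  obtain K where "max 0 (B / (\<mu> * A\<^sup>2)) < real K"
    using reals_Archimedean2 by blast
  then have K: "0 < K" "B * real K < \<mu> * (A * real K)\<^sup>2"
    using A(1) assms(4) by (auto simp: field_simps power2_eq_square)
  have u: "smooth (?u K)" "compact_support (?u K)"
    by (intro smooth_multiscale smooth_cutoff compact_support_multiscale compact_support_cutoff R)+
  moreover have "0 < Gamma2 \<beta> (?u K) x" if "norm x \<le> R" for x
    by (intro Gamma2_pos assms u multiscale_nonneg cutoff_nonneg multiscale_cutoff_pos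
        R order_trans[OF that] K)
  moreover have "Gamma2 \<beta> (?u K) x < \<mu> * (fracL \<beta> (?u K) x)\<^sup>2" if "norm x \<le> R" for x
  proof -
    have "\<mu> * (A * real K)\<^sup>2 \<le> \<mu> * \<bar>fracL \<beta> (?u K) x\<bar>\<^sup>2"
      using A that assms(4) by (intro mult_left_mono power_mono) auto
    then show ?thesis
      using B[of K x] K(2) by simp
  qed
  ultimately show ?thesis by blast
qed

end
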